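(* Let $p$ be an odd prime, $k=\mathbb{F}_p$, $K=\mathbb{F}_p((t))$ the field of formal Laurent series over $\mathbb{F}_p$, $W=\mathbb{F}_pt$, and let $Q=Q_{k<K}(W)$ be the loop on $W\times K=\mathbb{F}_pt\times\mathbb{F}_p((t))$ with multiplication $(a,u)(b,v)=(a+b,\;u(1+b)+v(1-a))$. Let $L=\langle (t,0),(0,1)\rangle$ be the subloop of $Q$ generated by $(t,0)$ and $(0,1)$. Then $L=W\times U$, where $U\subseteq K$ is the localization of $\mathbb{F}_p[t]$ with respect to $\{1+a:a\in W\}$. Moreover, $L$ is an infinite nonassociative $2$-generated abelian-by-cyclic automorphic loop of exponent $p$.
   Context: A loop is a set with a binary operation having a two-sided identity element and such that all translations $L_x:y\mapsto xy$ and $R_x:y\mapsto yx$ are bijections; a subloop is a subset closed under multiplication and under left and right division, and the subloop generated by a set is the smallest subloop containing it. A loop is automorphic if every element of the group generated by all $L_x,R_x$ that fixes the identity element is an automorphism of the loop. The localization of $\mathbb{F}_p[t]$ with respect to $\{1+a:a\in W\}$ is the subring of $K$ generated by $\mathbb{F}_p[t]$ and all $(1+a)^{-1}$, $a\in W$. A loop is abelian-by-cyclic if it has a normal subloop (kernel of a loop homomorphism) that is an abelian group with the quotient a cyclic group. A loop whose one-generated subloops are all groups (as is true for automorphic loops) has exponent $p$ ($p$ prime) if it is nontrivial and $x^p$ is the identity for every element $x$. *)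

theory Defs
  imports
    "HOL-Algebra.Algebra"
    "HOL-Computational_Algebra.Computational_Algebra"
    "Jordan_Normal_Form.VS_Connect"
    "Berlekamp_Zassenhaus.Finite_Field"
begin

section \<open>Loops\<close>

text \<open>Loops are carried by the record type of monoids, so that the notions of
  \<^theory>\<open>HOL-Algebra.Group\<close> that do not depend on associativity can be used as they stand.\<close>

locale loop =
  fixes G (structure)
  assumes m_closed: "\<lbrakk>x \<in> carrier G; y \<in> carrier G\<rbrakk> \<Longrightarrow> x \<otimes> y \<in> carrier G"
    and one_closed: "\<one> \<in> carrier G"
    and l_one: "x \<in> carrier G \<Longrightarrow> \<one> \<otimes> x = x"
    and r_one: "x \<in> carrier G \<Longrightarrow> x \<otimes> \<one> = x"
    and bij_l_mult: "x \<in> carrier G \<Longrightarrow> bij_betw (\<lambda>y. x \<otimes> y) (carrier G) (carrier G)"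
    and bij_r_mult: "x \<in> carrier G \<Longrightarrow> bij_betw (\<lambda>y. y \<otimes> x) (carrier G) (carrier G)"

definition left_div :: "('a, 'm) monoid_scheme \<Rightarrow> 'a \<Rightarrow> 'a \<Rightarrow> 'a" where
  "left_div G x y = (THE z. z \<in> carrier G \<and> x \<otimes>\<^bsub>G\<^esub> z = y)"

definition right_div :: "('a, 'm) monoid_scheme \<Rightarrow> 'a \<Rightarrow> 'a \<Rightarrow> 'a" where
  "right_div G y x = (THE z. z \<in> carrier G \<and> z \<otimes>\<^bsub>G\<^esub> x = y)"

text \<open>A nonempty subset closed under the divisions contains the identity element, so
  nonemptiness only excludes the empty set, which is not a loop.\<close>

definition subloop :: "'a set \<Rightarrow> ('a, 'm) monoid_scheme \<Rightarrow> bool" where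
  "subloop H G \<longleftrightarrow> H \<subseteq> carrier G \<and> H \<noteq> {} \<and>
     (\<forall>x\<in>H. \<forall>y\<in>H. x \<otimes>\<^bsub>G\<^esub> y \<in> H \<and> left_div G x y \<in> H \<and> right_div G y x \<in> H)"

definition loop_generate :: "('a, 'm) monoid_scheme \<Rightarrow> 'a set \<Rightarrow> 'a set" where
  "loop_generate G S = \<Inter>{H. subloop H G \<and> S \<subseteq> H}"

abbreviation subloop_generated :: "('a, 'm) monoid_scheme \<Rightarrow> 'a set \<Rightarrow> ('a, 'm) monoid_scheme"
  where "subloop_generated G S \<equiv> G\<lparr>carrier := loop_generate G S\<rparr>"

definition left_translation :: "('a, 'm) monoid_scheme \<Rightarrow> 'a \<Rightarrow> 'a \<Rightarrow> 'a" where
  "left_translation G x = (\<lambda>y\<in>carrier G. x \<otimes>\<^bsub>G\<^esub> y)"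

definition right_translation :: "('a, 'm) monoid_scheme \<Rightarrow> 'a \<Rightarrow> 'a \<Rightarrow> 'a" where
  "right_translation G x = (\<lambda>y\<in>carrier G. y \<otimes>\<^bsub>G\<^esub> x)"

definition mult_group :: "('a, 'm) monoid_scheme \<Rightarrow> ('a \<Rightarrow> 'a) set" where
  "mult_group G = generate (BijGroup (carrier G))
     (left_translation G ` carrier G \<union> right_translation G ` carrier G)"

definition automorphic_loop :: "('a, 'm) monoid_scheme \<Rightarrow> bool" where
  "automorphic_loop G \<longleftrightarrow> loop G \<and> (\<forall>f\<in>mult_group G. f \<one>\<^bsub>G\<^esub> = \<one>\<^bsub>G\<^esub> \<longrightarrow> f \<in> auto G)"

text \<open>Replacing the codomain of a homomorphism by its image, and an element of the image by its
  fibre, any kernel of a loop homomorphism is the kernel of one into a loop of subsets of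
  the domain. So nothing is lost by fixing the element type of the codomain.\<close>

definition normal_subloop :: "'a set \<Rightarrow> ('a, 'm) monoid_scheme \<Rightarrow> bool" where
  "normal_subloop N G \<longleftrightarrow>
     (\<exists>(M :: 'a set monoid) h. loop M \<and> h \<in> hom G M \<and> N = kernel G M h)"

text \<open>For a normal subloop \<open>N\<close> of a loop, the cosets of \<open>N\<close> are the fibres of the homomorphism
  and \<open>(N x)(N y) = N (x y)\<close> as a product of sets, so \<^const>\<open>FactGroup\<close> is the quotient loop.\<close>

definition abelian_by_cyclic :: "('a, 'm) monoid_scheme \<Rightarrow> bool" where
  "abelian_by_cyclic G \<longleftrightarrow> loop G \<and>
     (\<exists>N. normal_subloop N G \<and> comm_group (G\<lparr>carrier := N\<rparr>) \<and>
          group (G Mod N) \<and> cyclic_group (G Mod N))"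

definition associative_loop :: "('a, 'm) monoid_scheme \<Rightarrow> bool" where
  "associative_loop G \<longleftrightarrow>
     (\<forall>x\<in>carrier G. \<forall>y\<in>carrier G. \<forall>z\<in>carrier G.
        (x \<otimes>\<^bsub>G\<^esub> y) \<otimes>\<^bsub>G\<^esub> z = x \<otimes>\<^bsub>G\<^esub> (y \<otimes>\<^bsub>G\<^esub> z))"

definition two_generated :: "('a, 'm) monoid_scheme \<Rightarrow> bool" where
  "two_generated G \<longleftrightarrow> (\<exists>x\<in>carrier G. \<exists>y\<in>carrier G. loop_generate G {x, y} = carrier G)"

definition has_prime_exponent :: "('a, 'm) monoid_scheme \<Rightarrow> nat \<Rightarrow> bool" where
  "has_prime_exponent G p \<longleftrightarrow> Factorial_Ring.prime p \<and>
     (\<forall>x\<in>carrier G. group (subloop_generated G {x})) \<and>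
     carrier G \<noteq> {\<one>\<^bsub>G\<^esub>} \<and>
     (\<forall>x\<in>carrier G. x [^]\<^bsub>G\<^esub> p = \<one>\<^bsub>G\<^esub>)"


section \<open>The construction\<close>

text \<open>The field \<open>k\<close> of \<open>Q\<^bsub>k<K\<^esub>(W)\<close> only serves to say that \<open>W\<close> is a \<open>k\<close>-subspace of \<open>K\<close>; it does
  not occur in the multiplication.\<close>

definition Q_loop :: "'k::field set \<Rightarrow> ('k \<times> 'k) monoid" where
  "Q_loop W = \<lparr>carrier = W \<times> UNIV,
     monoid.mult = (\<lambda>(a, u) (b, v). (a + b, u * (1 + b) + v * (1 - a))),
     one = (0, 0)\<rparr>"

text \<open>The subring generated by \<open>F[t]\<close> and the inverses of the elements \<open>1 + a\<close>, inside the field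
  of formal Laurent series over \<open>F\<close>.\<close>

definition poly_localization :: "'a::field fls set \<Rightarrow> 'a fls set" where
  "poly_localization W = generate_ring class_ring
     (range (\<lambda>f :: 'a poly. fps_to_fls (fps_of_poly f)) \<union> {inverse (1 + a) |a. a \<in> W})"

lemma loop_Q_loop:
  fixes W :: "'k::field set"
  assumes zero: "0 \<in> W" and diff: "\<And>a b. a \<in> W \<Longrightarrow> b \<in> W \<Longrightarrow> a - b \<in> W"
    and unit: "\<And>a. a \<in> W \<Longrightarrow> 1 + a \<noteq> 0"
  shows "loop (Q_loop W)"
proof -
  have neg: "- a \<in> W" if "a \<in> W" for a using diff[OF zero that] by simp
  have add: "a + b \<in> W" if "a \<in> W" "b \<in> W" for a b
    using diff[OF that(1) neg[OF that(2)]] by simp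
  have unit': "1 - a \<noteq> 0" if "a \<in> W" for a using unit[OF neg[OF that]] by simp
  show ?thesis
  proof
    fix x assume "x \<in> carrier (Q_loop W)"
    then obtain a u where x: "x = (a, u)" and a: "a \<in> W"
      by (auto simp: Q_loop_def)
    show "bij_betw (\<lambda>y. x \<otimes>\<^bsub>Q_loop W\<^esub> y) (carrier (Q_loop W)) (carrier (Q_loop W))"
      by (rule bij_betw_byWitness
          [where f' = "\<lambda>(c, w). (c - a, (w - u * (1 + (c - a))) / (1 - a))"])
        (use a unit'[OF a] in \<open>auto simp: x Q_loop_def add diff\<close>)
    show "bij_betw (\<lambda>y. y \<otimes>\<^bsub>Q_loop W\<^esub> x) (carrier (Q_loop W)) (carrier (Q_loop W))"
      by (rule bij_betw_byWitness
          [where f' = "\<lambda>(c, w). (c - a, (w - u * (1 - (c - a))) / (1 + a))"])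
        (use a unit[OF a] in \<open>auto simp: x Q_loop_def add diff\<close>)
  qed (auto simp: Q_loop_def zero add)
qed

lemma loop_Q_loop_fls:
  "loop (Q_loop (range (\<lambda>c :: 'p::prime_card mod_ring. fls_const c * fls_X)))"
proof (rule loop_Q_loop)
  show "0 \<in> range (\<lambda>c :: 'p mod_ring. fls_const c * fls_X)"
    by (rule image_eqI[of _ _ 0]) auto
next
  fix a b :: "'p mod_ring fls"
  assume "a \<in> range (\<lambda>c. fls_const c * fls_X)" "b \<in> range (\<lambda>c. fls_const c * fls_X)"
  then obtain c d where "a = fls_const c * fls_X" "b = fls_const d * fls_X" by auto
  then have "a - b = fls_const (c - d) * fls_X"
    by (simp add: left_diff_distrib flip: fls_minus_const)
  then show "a - b \<in> range (\<lambda>c. fls_const c * fls_X)" by blast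
next
  fix a :: "'p mod_ring fls"
  assume "a \<in> range (\<lambda>c. fls_const c * fls_X)"
  then obtain c where "a = fls_const c * fls_X" by auto
  then have "fls_nth (1 + a) 0 = 1" by simp
  then show "1 + a \<noteq> 0" by (metis fls_zero_nth zero_neq_one)
qed

end

theory Submission
  imports Defs
begin

text \<open>Write \<open>t\<close> for the generator of \<open>W\<close>. Dividing by \<open>(a, u)\<close> in \<open>Q\<close> only involves division by
  \<open>1 + a\<close> or \<open>1 - a = 1 + (- a)\<close>, so \<open>W \<times> U\<close> is a subloop for every subring \<open>U\<close> that contains \<open>W\<close>
  and the inverses of the \<open>1 + a\<close>. The localization is such a ring, hence \<open>L \<subseteq> W \<times> U\<close>.

  For the other inclusion let \<open>H\<close> be a subloop containing \<open>(t, 0)\<close> and \<open>(0, 1)\<close>. It contains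
  \<open>W \<times> {0}\<close>, and \<open>V = {v. (0, v) \<in> H}\<close> is an additive group. The elements \<open>r\<close> with \<open>r V \<subseteq> V\<close> form
  a ring \<open>R\<close>, and it is enough that \<open>U \<subseteq> R\<close>, since \<open>1 \<in> V\<close>. Going from \<open>(0, v)\<close> up to the first
  coordinate \<open>a\<close> by multiplying with \<open>(a, 0)\<close> on the left and back by dividing by it on the right
  shows that \<open>(1 - a) / (1 + a) = 2 / (1 + a) - 1\<close> lies in \<open>R\<close>; as \<open>p\<close> is odd, 2 is invertible in
  the prime field and \<open>1 / (1 + a) \<in> R\<close> (\<open>multipliers_inverse\<close>). Going up with \<open>(a, 0)\<close> and down
  with \<open>(- a, 0)\<close>, both on the right, gives \<open>1 - a\<^sup>2 \<in> R\<close> (\<open>multipliers_square\<close>). Finally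
  \<open>a = a\<^sup>2 / (1 + a) + 1 - 1 / (1 + a)\<close> gives \<open>t \<in> R\<close> (\<open>multipliers_W\<close>).

  The structural properties hold for all the loops \<open>W \<times> U\<close> and come from explicit formulas.
  Translations, and so all elements of the multiplication group, have the form
  \<open>(b, v) \<mapsto> (b + c, r v + s + m b)\<close> with \<open>r \<noteq> 0\<close>; if such a map fixes \<open>(0, 0)\<close> then
  \<open>c = s = 0\<close>, and \<open>(b, v) \<mapsto> (b, r v + m b)\<close> respects the multiplication
  (\<open>automorphic_WU\<close>). The multiples satisfy \<open>(i a, i u) (j a, j u) = ((i + j) a, (i + j) u)\<close>, which
  makes one-generated subloops groups of exponent \<open>p\<close> (\<open>group_one_generated\<close>,
  \<open>prime_exponent_WU\<close>). The projection to \<open>W\<close> has the kernel \<open>{0} \<times> U\<close>, on which the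
  multiplication is the addition of \<open>U\<close> (\<open>abelian_by_cyclic_WU\<close>).\<close>

section \<open>Subloops of a loop\<close>

context loop
begin

lemma left_div_unique:
  assumes "x \<in> carrier G" "z \<in> carrier G" "x \<otimes> z = y"
  shows "left_div G x y = z"
  unfolding left_div_def
proof (rule the_equality)
  fix z' assume "z' \<in> carrier G \<and> x \<otimes> z' = y"
  then show "z' = z"
    using bij_betw_imp_inj_on[OF bij_l_mult[OF assms(1)]] assms by (metis inj_onD)
qed (use assms in simp)

lemma right_div_unique:
  assumes "x \<in> carrier G" "z \<in> carrier G" "z \<otimes> x = y"
  shows "right_div G y x = z"
  unfolding right_div_def
proof (rule the_equality)
  fix z' assume "z' \<in> carrier G \<and> z' \<otimes> x = y"
  then show "z' = z"
    using bij_betw_imp_inj_on[OF bij_r_mult[OF assms(1)]] assms by (metis inj_onD)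
qed (use assms in simp)

lemma left_div_closed: "left_div G x y \<in> carrier G"
  and mult_left_div: "x \<otimes> left_div G x y = y"
  if xy: "x \<in> carrier G" "y \<in> carrier G"
proof -
  obtain z where "z \<in> carrier G" "x \<otimes> z = y"
    using bij_betw_imp_surj_on[OF bij_l_mult[OF xy(1)]] xy(2) by (metis imageE)
  then show "left_div G x y \<in> carrier G" "x \<otimes> left_div G x y = y"
    using left_div_unique[OF xy(1)] by auto
qed

lemma right_div_closed: "right_div G y x \<in> carrier G"
  and right_div_mult: "right_div G y x \<otimes> x = y"
  if xy: "x \<in> carrier G" "y \<in> carrier G"
proof -
  obtain z where "z \<in> carrier G" "z \<otimes> x = y"
    using bij_betw_imp_surj_on[OF bij_r_mult[OF xy(1)]] xy(2) by (metis imageE)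
  then show "right_div G y x \<in> carrier G" "right_div G y x \<otimes> x = y"
    using right_div_unique[OF xy(1)] by auto
qed

lemma subloop_one:
  assumes "subloop H G" shows "\<one> \<in> H"
proof -
  obtain x where x: "x \<in> H" "x \<in> carrier G" "left_div G x x \<in> H"
    using assms unfolding subloop_def by blast
  moreover have "left_div G x x = \<one>"
    using x by (intro left_div_unique) (auto simp: one_closed r_one)
  ultimately show ?thesis by simp
qed

lemma subloop_imp_loop:
  assumes "subloop H G" shows "loop (G\<lparr>carrier := H\<rparr>)"
proof -
  have sub: "x \<in> carrier G" if "x \<in> H" for x
    using assms that by (auto simp: subloop_def)
  have cl: "x \<otimes> y \<in> H" "left_div G x y \<in> H" "right_div G y x \<in> H" if "x \<in> H" "y \<in> H" for x y
    using assms that by (auto simp: subloop_def)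
  show ?thesis
  proof
    fix x assume "x \<in> carrier (G\<lparr>carrier := H\<rparr>)"
    then have x: "x \<in> H" by simp
    show "bij_betw (\<lambda>y. x \<otimes>\<^bsub>G\<lparr>carrier := H\<rparr>\<^esub> y) (carrier (G\<lparr>carrier := H\<rparr>)) (carrier (G\<lparr>carrier := H\<rparr>))"
      by (rule bij_betw_byWitness[where f' = "left_div G x"])
        (use x in \<open>auto simp: cl sub mult_left_div intro!: left_div_unique\<close>)
    show "bij_betw (\<lambda>y. y \<otimes>\<^bsub>G\<lparr>carrier := H\<rparr>\<^esub> x) (carrier (G\<lparr>carrier := H\<rparr>)) (carrier (G\<lparr>carrier := H\<rparr>))"
      by (rule bij_betw_byWitness[where f' = "\<lambda>y. right_div G y x"])
        (use x in \<open>auto simp: cl sub right_div_mult intro!: right_div_unique\<close>)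
  qed (use assms in \<open>auto simp: cl sub subloop_one l_one r_one\<close>)
qed

text \<open>The divisions of a subloop are the restrictions of the ambient ones, because quotients
  are unique; this lets generated subloops be computed in the ambient loop.\<close>

lemma subloop_of_subloop:
  assumes "subloop H G"
  shows "subloop K (G\<lparr>carrier := H\<rparr>) \<longleftrightarrow> subloop K G \<and> K \<subseteq> H"
proof -
  interpret H: loop "G\<lparr>carrier := H\<rparr>" by (rule subloop_imp_loop[OF assms])
  have sub: "x \<in> carrier G" if "x \<in> H" for x
    using assms that by (auto simp: subloop_def)
  have ld: "left_div (G\<lparr>carrier := H\<rparr>) x y = left_div G x y"
    and rd: "right_div (G\<lparr>carrier := H\<rparr>) y x = right_div G y x" if "x \<in> H" "y \<in> H" for x y
    using that assms sub mult_left_div[of x y] right_div_mult[of x y]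
    by (auto simp: subloop_def intro!: H.left_div_unique H.right_div_unique)
  have "(\<forall>x\<in>K. \<forall>y\<in>K. x \<otimes> y \<in> K \<and> left_div (G\<lparr>carrier := H\<rparr>) x y \<in> K \<and>
      right_div (G\<lparr>carrier := H\<rparr>) y x \<in> K) \<longleftrightarrow>
    (\<forall>x\<in>K. \<forall>y\<in>K. x \<otimes> y \<in> K \<and> left_div G x y \<in> K \<and> right_div G y x \<in> K)" if "K \<subseteq> H"
    using that ld rd by (metis subsetD)
  then show ?thesis
    using sub by (auto simp: subloop_def)
qed

lemma subloop_carrier: "carrier G \<noteq> {} \<Longrightarrow> subloop (carrier G) G"
  by (simp add: subloop_def m_closed left_div_closed right_div_closed)

lemma loop_generate_least: "subloop H G \<Longrightarrow> S \<subseteq> H \<Longrightarrow> loop_generate G S \<subseteq> H"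
  by (auto simp: loop_generate_def)

lemma loop_generate_incl: "S \<subseteq> loop_generate G S"
  by (auto simp: loop_generate_def)

lemma subloop_loop_generate:
  assumes "S \<subseteq> carrier G" shows "subloop (loop_generate G S) G"
proof -
  have car: "subloop (carrier G) G"
    using one_closed by (intro subloop_carrier) auto
  have "\<one> \<in> loop_generate G S"
    by (auto simp: loop_generate_def subloop_one)
  moreover have "loop_generate G S \<subseteq> carrier G"
    by (rule loop_generate_least[OF car assms])
  moreover have "x \<otimes> y \<in> loop_generate G S" "left_div G x y \<in> loop_generate G S"
    "right_div G y x \<in> loop_generate G S"
    if "x \<in> loop_generate G S" "y \<in> loop_generate G S" for x y
    using that unfolding loop_generate_def subloop_def by blast+
  ultimately show ?thesis unfolding subloop_def by (intro conjI ballI) (assumption | blast)+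
qed

lemma loop_generate_in_subloop:
  assumes "subloop H G" "S \<subseteq> H"
  shows "loop_generate (G\<lparr>carrier := H\<rparr>) S = loop_generate G S"
proof
  have "S \<subseteq> carrier G" using assms by (auto simp: subloop_def)
  then have "subloop (loop_generate G S) G" "loop_generate G S \<subseteq> H"
    using assms by (auto intro: subloop_loop_generate loop_generate_least[THEN subsetD])
  then have "subloop (loop_generate G S) (G\<lparr>carrier := H\<rparr>)"
    by (simp add: subloop_of_subloop[OF assms(1)])
  then show "loop_generate (G\<lparr>carrier := H\<rparr>) S \<subseteq> loop_generate G S"
    using loop.loop_generate_least[OF subloop_imp_loop[OF assms(1)]] loop_generate_incl by blast
  show "loop_generate G S \<subseteq> loop_generate (G\<lparr>carrier := H\<rparr>) S"
    using subloop_of_subloop[OF assms(1)] by (auto simp: loop_generate_def)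
qed

lemma associative_imp_group:
  assumes "associative_loop G" shows "group G"
proof (rule groupI)
  fix x assume x: "x \<in> carrier G"
  show "\<exists>y\<in>carrier G. y \<otimes> x = \<one>"
    using right_div_closed[OF x one_closed] right_div_mult[OF x one_closed] by blast
qed (use assms in \<open>auto simp: associative_loop_def m_closed one_closed l_one\<close>)

end

lemma group_imp_loop:
  assumes "group G" shows "loop G"
proof -
  interpret group G by (rule assms)
  show ?thesis
  proof
    fix x assume x: "x \<in> carrier G"
    show "bij_betw (\<lambda>y. x \<otimes>\<^bsub>G\<^esub> y) (carrier G) (carrier G)"
      by (rule bij_betw_byWitness[where f' = "\<lambda>y. inv\<^bsub>G\<^esub> x \<otimes>\<^bsub>G\<^esub> y"])
        (use x in \<open>auto simp flip: m_assoc\<close>)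
    show "bij_betw (\<lambda>y. y \<otimes>\<^bsub>G\<^esub> x) (carrier G) (carrier G)"
      by (rule bij_betw_byWitness[where f' = "\<lambda>y. y \<otimes>\<^bsub>G\<^esub> inv\<^bsub>G\<^esub> x"])
        (use x in \<open>auto simp: m_assoc\<close>)
  qed auto
qed

section \<open>The loops \<open>W \<times> U\<close>\<close>

text \<open>These conditions make \<open>W \<times> U\<close> closed under both divisions, where the divisors are \<open>1 - a\<close>
  and \<open>1 + a\<close>; as \<open>W\<close> contains \<open>- a\<close>, the inverse of \<open>1 - a\<close> lies in \<open>U\<close> too.\<close>

locale Q_subloop =
  fixes W U :: "'k::field set"
  assumes W_zero: "0 \<in> W" and W_diff: "\<And>a b. a \<in> W \<Longrightarrow> b \<in> W \<Longrightarrow> a - b \<in> W"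
    and unit: "\<And>a. a \<in> W \<Longrightarrow> 1 + a \<noteq> 0"
    and U_one: "1 \<in> U" and U_diff: "\<And>u v. u \<in> U \<Longrightarrow> v \<in> U \<Longrightarrow> u - v \<in> U"
    and U_mult: "\<And>u v. u \<in> U \<Longrightarrow> v \<in> U \<Longrightarrow> u * v \<in> U"
    and W_sub_U: "W \<subseteq> U"
    and U_inverse: "\<And>a. a \<in> W \<Longrightarrow> inverse (1 + a) \<in> U"
begin

abbreviation WU :: "('k \<times> 'k) monoid" where
  "WU \<equiv> (Q_loop W)\<lparr>carrier := W \<times> U\<rparr>"

lemma W_uminus: "a \<in> W \<Longrightarrow> - a \<in> W"
  using W_diff[OF W_zero] by simp

lemma W_add: "a \<in> W \<Longrightarrow> b \<in> W \<Longrightarrow> a + b \<in> W"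
  using W_diff[of a "- b"] W_uminus by simp

lemma unit': "a \<in> W \<Longrightarrow> 1 - a \<noteq> 0"
  using unit[OF W_uminus] by simp

lemma U_zero: "0 \<in> U"
  using W_zero W_sub_U by auto

lemma U_uminus: "u \<in> U \<Longrightarrow> - u \<in> U"
  using U_diff[OF U_zero] by simp

lemma U_add: "u \<in> U \<Longrightarrow> v \<in> U \<Longrightarrow> u + v \<in> U"
  using U_diff[of u "- v"] U_uminus by simp

lemma W_in_U: "a \<in> W \<Longrightarrow> a \<in> U"
  using W_sub_U by blast

lemma U_divide: "u \<in> U \<Longrightarrow> a \<in> W \<Longrightarrow> u / (1 + a) \<in> U"
  by (simp add: divide_inverse U_mult U_inverse)

lemma U_divide': "u \<in> U \<Longrightarrow> a \<in> W \<Longrightarrow> u / (1 - a) \<in> U"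
  using U_divide[OF _ W_uminus] by simp

lemmas WU_closed = W_zero W_add W_diff W_uminus U_zero U_one U_add U_diff U_uminus U_mult W_in_U
  U_divide U_divide'

sublocale Q: loop "Q_loop W"
  by (intro loop_Q_loop W_zero W_diff unit)

lemma mult_Q: "(a, u) \<otimes>\<^bsub>Q_loop W\<^esub> (b, v) = (a + b, u * (1 + b) + v * (1 - a))"
  by (simp add: Q_loop_def)

lemma one_Q: "\<one>\<^bsub>Q_loop W\<^esub> = (0, 0)"
  by (simp add: Q_loop_def)

lemma carrier_Q: "carrier (Q_loop W) = W \<times> UNIV"
  by (simp add: Q_loop_def)

lemma left_div_Q:
  assumes "a \<in> W" "c \<in> W"
  shows "left_div (Q_loop W) (a, u) (c, w) = (c - a, (w - u * (1 + (c - a))) / (1 - a))"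
  using assms unit'[of a] by (intro Q.left_div_unique) (auto simp: carrier_Q mult_Q WU_closed)

lemma right_div_Q:
  assumes "a \<in> W" "c \<in> W"
  shows "right_div (Q_loop W) (c, w) (a, u) = (c - a, (w - u * (1 - (c - a))) / (1 + a))"
  using assms unit[of a] by (intro Q.right_div_unique) (auto simp: carrier_Q mult_Q WU_closed)

lemma subloop_WU: "subloop (W \<times> U) (Q_loop W)"
  unfolding subloop_def
proof (intro conjI)
  show "W \<times> U \<noteq> {}" using W_zero U_zero by blast
qed (auto simp: carrier_Q mult_Q left_div_Q right_div_Q WU_closed)

sublocale WU: loop WU
  by (rule Q.subloop_imp_loop[OF subloop_WU])

subsection \<open>Inner mappings\<close>

text \<open>The coefficients \<open>r\<close>, \<open>s\<close>, \<open>m\<close> range over the whole field: only the shape of the map matters,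
  and that a map is a bijection of \<open>W \<times> U\<close> is recorded separately.\<close>

definition affine_map :: "('k \<times> 'k \<Rightarrow> 'k \<times> 'k) \<Rightarrow> bool" where
  "affine_map f \<longleftrightarrow> (\<exists>c\<in>W. \<exists>r s m. r \<noteq> 0 \<and>
     (\<forall>b\<in>W. \<forall>v\<in>U. f (b, v) = (b + c, r * v + s + m * b)))"

lemma affine_map_I:
  assumes "c \<in> W" "r \<noteq> 0"
    "\<And>b v. b \<in> W \<Longrightarrow> v \<in> U \<Longrightarrow> f (b, v) = (b + c, r * v + s + m * b)"
  shows "affine_map f"
  using assms unfolding affine_map_def by blast

lemma affine_left_translation:
  assumes "x \<in> W \<times> U" shows "affine_map (left_translation WU x)"
proof -
  obtain a u where "x = (a, u)" "a \<in> W" "u \<in> U" using assms by auto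
  then show ?thesis
    using unit'[of a]
    by (intro affine_map_I[of a "1 - a" _ u u]) (auto simp: left_translation_def mult_Q algebra_simps)
qed

lemma affine_right_translation:
  assumes "x \<in> W \<times> U" shows "affine_map (right_translation WU x)"
proof -
  obtain a u where "x = (a, u)" "a \<in> W" "u \<in> U" using assms by auto
  then show ?thesis
    by (intro affine_map_I[of a "1 + a" _ u "- u"])
      (auto simp: right_translation_def mult_Q unit algebra_simps)
qed

text \<open>Solving \<open>(b' + c, r v' + s + m b') = (b, v)\<close> for \<open>(b', v')\<close> gives
  \<open>b' = b - c\<close> and \<open>v' = (v - s - m (b - c)) / r\<close>, again of the same shape.\<close>

lemma affine_map_inverse:
  assumes f: "f \<in> Bij (W \<times> U)" "affine_map f"
  shows "affine_map (inv\<^bsub>BijGroup (W \<times> U)\<^esub> f)"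
proof -
  obtain c r s m where c: "c \<in> W" "r \<noteq> 0"
    and eq: "\<And>b v. b \<in> W \<Longrightarrow> v \<in> U \<Longrightarrow> f (b, v) = (b + c, r * v + s + m * b)"
    using f(2) unfolding affine_map_def by blast
  have bij: "bij_betw f (W \<times> U) (W \<times> U)" using f(1) by (simp add: Bij_def)
  show ?thesis
  proof (rule affine_map_I[of "- c" "1 / r" _ "(m * c - s) / r" "- m / r"])
    fix b v assume bv: "b \<in> W" "v \<in> U"
    then have "(b, v) \<in> f ` (W \<times> U)" using bij_betw_imp_surj_on[OF bij] by simp
    then obtain b' v' where bv': "b' \<in> W" "v' \<in> U" "f (b', v') = (b, v)" by force
    have "inv_into (W \<times> U) f (b, v) = (b', v')"
      using bv' bij by (intro inv_into_f_eq) (auto simp: bij_betw_def)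
    then show "(inv\<^bsub>BijGroup (W \<times> U)\<^esub> f) (b, v) = (b + - c, 1 / r * v + (m * c - s) / r + - m / r * b)"
      using bv bv' eq[of b' v'] \<open>r \<noteq> 0\<close> by (auto simp: inv_BijGroup[OF f(1)] field_simps)
  qed (use c in \<open>auto simp: WU_closed\<close>)
qed

lemma affine_map_compose:
  assumes f: "g \<in> Bij (W \<times> U)" "affine_map f" "affine_map g"
  shows "affine_map (compose (W \<times> U) f g)"
proof -
  obtain c r s m where c: "c \<in> W" "r \<noteq> 0"
    and eq: "\<And>b v. b \<in> W \<Longrightarrow> v \<in> U \<Longrightarrow> f (b, v) = (b + c, r * v + s + m * b)"
    using f(2) unfolding affine_map_def by blast
  obtain c' r' s' m' where c': "c' \<in> W" "r' \<noteq> 0"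
    and eq': "\<And>b v. b \<in> W \<Longrightarrow> v \<in> U \<Longrightarrow> g (b, v) = (b + c', r' * v + s' + m' * b)"
    using f(3) unfolding affine_map_def by blast
  show ?thesis
  proof (rule affine_map_I[of "c + c'" "r * r'" _ "r * s' + s + m * c'" "r * m' + m"])
    fix b v assume bv: "b \<in> W" "v \<in> U"
    then have "g (b, v) \<in> W \<times> U" using Bij_imp_funcset[OF f(1)] by auto
    then show "compose (W \<times> U) f g (b, v) =
        (b + (c + c'), r * r' * v + (r * s' + s + m * c') + (r * m' + m) * b)"
      using bv by (simp add: compose_def eq' eq algebra_simps)
  qed (use c c' in \<open>auto simp: WU_closed\<close>)
qed

lemma translations_Bij:
  assumes "x \<in> W \<times> U"
  shows "left_translation WU x \<in> Bij (W \<times> U)" "right_translation WU x \<in> Bij (W \<times> U)"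
  using WU.bij_l_mult[of x] WU.bij_r_mult[of x] assms
  by (simp_all add: Bij_def left_translation_def right_translation_def bij_betw_def
      inj_on_restrict_eq cong: image_cong)

lemma mult_group_affine:
  assumes "f \<in> mult_group WU" shows "f \<in> Bij (W \<times> U) \<and> affine_map f"
proof -
  interpret B: group "BijGroup (W \<times> U)" by (rule group_BijGroup)
  have car: "carrier (BijGroup (W \<times> U)) = Bij (W \<times> U)" by (simp add: BijGroup_def)
  have "f \<in> generate (BijGroup (W \<times> U))
     (left_translation WU ` (W \<times> U) \<union> right_translation WU ` (W \<times> U))"
    using assms by (simp add: mult_group_def)
  then show ?thesis
  proof (induction rule: generate.induct)
    case one
    have "affine_map (\<lambda>x\<in>W \<times> U. x)"
      by (rule affine_map_I[of 0 1 _ 0 0]) (auto simp: WU_closed)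
    then have "(\<lambda>x\<in>W \<times> U. x) \<in> Bij (W \<times> U) \<and> affine_map (\<lambda>x\<in>W \<times> U. x)"
      using id_Bij by blast
    then show ?case by (simp only: BijGroup_def monoid.simps)
  next
    case (incl h)
    then show ?case
      using translations_Bij affine_left_translation affine_right_translation by blast
  next
    case (inv h)
    then have "h \<in> Bij (W \<times> U) \<and> affine_map h"
      using translations_Bij affine_left_translation affine_right_translation by blast
    then show ?case
      using affine_map_inverse B.inv_closed car by auto
  next
    case (eng h1 h2)
    then have "h1 \<otimes>\<^bsub>BijGroup (W \<times> U)\<^esub> h2 = compose (W \<times> U) h1 h2"
      by (simp add: BijGroup_def)
    then show ?case
      using eng.IH affine_map_compose compose_Bij by metis
  qed
qed

text \<open>Evaluating an affine map at \<open>(0, 0)\<close> gives \<open>(c, s)\<close>, so an inner mapping is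
  \<open>(b, v) \<mapsto> (b, r v + m b)\<close>. It is a homomorphism since the terms with \<open>m\<close> in the product of the
  images of \<open>(a, u)\<close> and \<open>(b, v)\<close> are \<open>m a (1 + b) + m b (1 - a) = m (a + b)\<close>: the mixed terms cancel.\<close>

lemma automorphic_WU: "automorphic_loop WU"
  unfolding automorphic_loop_def
proof (intro conjI ballI impI)
  fix f assume "f \<in> mult_group WU" and f1: "f \<one>\<^bsub>WU\<^esub> = \<one>\<^bsub>WU\<^esub>"
  then have f: "f \<in> Bij (W \<times> U)" "affine_map f" using mult_group_affine by auto
  then obtain c r s m where c: "c \<in> W" "r \<noteq> 0"
    and eq: "\<And>b v. b \<in> W \<Longrightarrow> v \<in> U \<Longrightarrow> f (b, v) = (b + c, r * v + s + m * b)"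
    unfolding affine_map_def by blast
  have cs: "c = 0" "s = 0"
    using f1 eq[OF W_zero U_zero] by (simp_all add: one_Q)
  have "f \<in> hom WU WU"
  proof (rule homI)
    fix x y assume "x \<in> carrier WU" "y \<in> carrier WU"
    then obtain a u b v where xy: "x = (a, u)" "y = (b, v)" "a \<in> W" "b \<in> W" "u \<in> U" "v \<in> U"
      by auto
    then show "f (x \<otimes>\<^bsub>WU\<^esub> y) = f x \<otimes>\<^bsub>WU\<^esub> f y"
      by (simp add: mult_Q eq cs WU_closed algebra_simps)
  qed (use Bij_imp_funcset[OF f(1)] in auto)
  then show "f \<in> auto WU" using f by (simp add: auto_def)
qed (rule WU.loop_axioms)

subsection \<open>The projection to \<open>W\<close>\<close>

definition fibre :: "'k \<Rightarrow> ('k \<times> 'k) set" where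
  "fibre a = {a} \<times> U"

lemma fibre_inj: "fibre a = fibre b \<longleftrightarrow> a = b"
  using U_zero by (auto simp: fibre_def)

text \<open>\<open>(0, v) (a, u) = (a, v (1 + a) + u)\<close>, and \<open>1 + a\<close> is a unit of \<open>U\<close>.\<close>

lemma r_coset_fibre:
  assumes "a \<in> W" "u \<in> U" shows "fibre 0 #>\<^bsub>Q_loop W\<^esub> (a, u) = fibre a"
proof -
  have "(a, v) \<in> fibre 0 #>\<^bsub>Q_loop W\<^esub> (a, u)" if "v \<in> U" for v
    using assms that unit[of a]
    by (auto simp: r_coset_def fibre_def mult_Q WU_closed intro!: bexI[of _ "(v - u) / (1 + a)"])
  then show ?thesis
    using assms by (auto simp: r_coset_def fibre_def mult_Q WU_closed)
qed

lemma set_mult_fibre: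
  assumes "a \<in> W" "b \<in> W" shows "fibre a <#>\<^bsub>Q_loop W\<^esub> fibre b = fibre (a + b)"
proof -
  have "(a + b, v) \<in> fibre a <#>\<^bsub>Q_loop W\<^esub> fibre b" if "v \<in> U" for v
  proof -
    have "(a, v / (1 + b)) \<in> fibre a" "(b, 0) \<in> fibre b"
      using assms that by (auto simp: fibre_def WU_closed)
    moreover have "(a + b, v) = (a, v / (1 + b)) \<otimes>\<^bsub>Q_loop W\<^esub> (b, 0)"
      using assms unit[of b] by (simp add: mult_Q)
    ultimately show ?thesis unfolding set_mult_def by blast
  qed
  then show ?thesis
    using assms by (auto simp: set_mult_def fibre_def mult_Q WU_closed)
qed

lemma carrier_quotient: "carrier (WU Mod fibre 0) = fibre ` W"
proof -
  have "carrier (WU Mod fibre 0) = (\<lambda>x. fibre 0 #>\<^bsub>Q_loop W\<^esub> x) ` (W \<times> U)"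
    by (simp add: carrier_FactGroup)
  also have "\<dots> = (\<lambda>x. fibre (fst x)) ` (W \<times> U)"
    by (rule image_cong) (auto simp: r_coset_fibre)
  also have "\<dots> = fibre ` fst ` (W \<times> U)" by (simp only: image_image)
  also have "fst ` (W \<times> U) = W" using U_zero by auto
  finally show ?thesis .
qed

lemma group_quotient: "group (WU Mod fibre 0)"
proof (rule groupI)
  fix x assume "x \<in> carrier (WU Mod fibre 0)"
  then obtain a where a: "x = fibre a" "a \<in> W" by (auto simp: carrier_quotient)
  then show "\<exists>y\<in>carrier (WU Mod fibre 0). y \<otimes>\<^bsub>WU Mod fibre 0\<^esub> x = \<one>\<^bsub>WU Mod fibre 0\<^esub>"
    by (auto simp: carrier_quotient set_mult_fibre WU_closed intro!: bexI[of _ "- a"])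
qed (auto simp: carrier_quotient set_mult_fibre WU_closed add_ac)

lemma normal_fibre: "normal_subloop (fibre 0) WU"
  unfolding normal_subloop_def
proof (intro exI conjI)
  show "loop (WU Mod fibre 0)" by (rule group_imp_loop[OF group_quotient])
  show "(\<lambda>x. fibre (fst x)) \<in> hom WU (WU Mod fibre 0)"
    by (rule homI) (auto simp: carrier_quotient set_mult_fibre mult_Q)
  show "fibre 0 = kernel WU (WU Mod fibre 0) (\<lambda>x. fibre (fst x))"
    by (auto simp: kernel_def fibre_inj W_zero) (auto simp: fibre_def W_zero)
qed

lemma comm_group_fibre: "comm_group (WU\<lparr>carrier := fibre 0\<rparr>)"
proof (rule comm_groupI)
  fix x assume "x \<in> carrier (WU\<lparr>carrier := fibre 0\<rparr>)"
  then obtain u where "x = (0, u)" "u \<in> U" by (auto simp: fibre_def)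
  then show "\<exists>y\<in>carrier (WU\<lparr>carrier := fibre 0\<rparr>). y \<otimes>\<^bsub>WU\<lparr>carrier := fibre 0\<rparr>\<^esub> x = \<one>\<^bsub>WU\<lparr>carrier := fibre 0\<rparr>\<^esub>"
    by (auto simp: fibre_def mult_Q one_Q WU_closed intro!: bexI[of _ "- u"])
qed (auto simp: fibre_def mult_Q one_Q WU_closed add_ac)

text \<open>The quotient is the additive group \<open>W\<close>, an image of the integers.\<close>

lemma cyclic_quotient:
  assumes W: "W = range (\<lambda>n. of_int n * w)"
  shows "cyclic_group (WU Mod fibre 0)"
proof (rule group.cyclic_group_epimorphic_image)
  have mem: "of_int n * w \<in> W" for n using W by blast
  show "(\<lambda>n. fibre (of_int n * w)) \<in> epi integer_group (WU Mod fibre 0)"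
    unfolding epi_def
  proof (intro CollectI conjI homI)
    show "(\<lambda>n. fibre (of_int n * w)) ` carrier integer_group = carrier (WU Mod fibre 0)"
      unfolding carrier_quotient by (subst W) (auto simp: carrier_integer_group)
  qed (auto simp: carrier_quotient set_mult_fibre mem distrib_right)
qed (auto simp: group_quotient)

lemma abelian_by_cyclic_WU:
  assumes "W = range (\<lambda>n. of_int n * w)" shows "abelian_by_cyclic WU"
  unfolding abelian_by_cyclic_def
  using WU.loop_axioms normal_fibre comm_group_fibre group_quotient cyclic_quotient[OF assms]
  by blast

subsection \<open>Powers and one-generated subloops\<close>

text \<open>In the induction step the second coordinate is \<open>n u (1 + a) + u (1 - n a) = (n + 1) u\<close>.\<close>

lemma nat_pow_WU: "(a, u) [^]\<^bsub>WU\<^esub> (n::nat) = (of_nat n * a, of_nat n * u)"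
  by (induction n) (auto simp: nat_pow_def one_Q mult_Q algebra_simps)

lemma U_of_int: "of_int n * u \<in> U" if "u \<in> U"
proof (induction n rule: int_induct[of _ 0])
qed (use that in \<open>auto simp: distrib_right left_diff_distrib WU_closed\<close>)

lemma W_of_int: "of_int n * a \<in> W" if "a \<in> W"
proof (induction n rule: int_induct[of _ 0])
qed (use that in \<open>auto simp: distrib_right left_diff_distrib WU_closed\<close>)

lemma subloop_int_multiples:
  assumes "a \<in> W" "u \<in> U"
  shows "subloop (range (\<lambda>n. (of_int n * a, of_int n * u))) WU" (is "subloop (range ?m) WU")
proof -
  have car: "?m n \<in> carrier WU" for n
    using assms by (simp add: W_of_int U_of_int)
  have mult: "?m i \<otimes>\<^bsub>WU\<^esub> ?m j = ?m (i + j)" for i j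
    by (simp add: mult_Q algebra_simps)
  have "left_div WU (?m i) (?m j) = ?m (j - i)" for i j
    by (rule WU.left_div_unique) (use car[of i] car[of "j - i"] mult[of i "j - i"] in auto)
  moreover have "right_div WU (?m j) (?m i) = ?m (j - i)" for i j
    by (rule WU.right_div_unique) (use car[of i] car[of "j - i"] mult[of "j - i" i] in auto)
  ultimately show ?thesis
    using car mult unfolding subloop_def by (fastforce simp only:)
qed

text \<open>The multiples of \<open>x\<close> form a subloop on which the multiplication is addition of
  coefficients, hence associative; the subloop generated by \<open>x\<close> lies in it.\<close>

lemma group_one_generated:
  assumes "x \<in> W \<times> U" shows "group (subloop_generated WU {x})"
proof -
  obtain a u where x: "x = (a, u)" "a \<in> W" "u \<in> U" using assms by auto
  let ?M = "range (\<lambda>n. (of_int n * a, of_int n * u))"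
  have "x \<in> ?M" by (rule range_eqI[of _ _ 1]) (simp add: x)
  then have sub: "loop_generate WU {x} \<subseteq> ?M"
    using WU.loop_generate_least[OF subloop_int_multiples[OF x(2,3)]] by simp
  have "subloop (loop_generate WU {x}) WU"
    by (rule WU.subloop_loop_generate) (use assms in simp)
  then have "loop (subloop_generated WU {x})"
    using WU.subloop_imp_loop by simp
  moreover have "associative_loop (subloop_generated WU {x})"
    unfolding associative_loop_def
  proof (intro ballI)
    fix y1 y2 y3
    assume "y1 \<in> carrier (subloop_generated WU {x})" "y2 \<in> carrier (subloop_generated WU {x})"
      "y3 \<in> carrier (subloop_generated WU {x})"
    then have "y1 \<in> ?M" "y2 \<in> ?M" "y3 \<in> ?M" using sub by auto
    then show "(y1 \<otimes>\<^bsub>subloop_generated WU {x}\<^esub> y2) \<otimes>\<^bsub>subloop_generated WU {x}\<^esub> y3 =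
        y1 \<otimes>\<^bsub>subloop_generated WU {x}\<^esub> (y2 \<otimes>\<^bsub>subloop_generated WU {x}\<^esub> y3)"
      by (auto simp: mult_Q algebra_simps)
  qed
  ultimately show ?thesis by (rule loop.associative_imp_group)
qed

lemma prime_exponent_WU:
  assumes "Factorial_Ring.prime p" "of_nat p = (0 :: 'k)"
  shows "has_prime_exponent WU p"
proof -
  have "(0, 1) \<in> carrier WU" by (simp add: WU_closed)
  moreover have "(0, 1) \<noteq> \<one>\<^bsub>WU\<^esub>" by (simp add: one_Q)
  ultimately have "carrier WU \<noteq> {\<one>\<^bsub>WU\<^esub>}" by blast
  moreover have "x [^]\<^bsub>WU\<^esub> p = \<one>\<^bsub>WU\<^esub>" for x
    by (cases x) (simp only: nat_pow_WU, simp add: assms(2) one_Q)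
  ultimately show ?thesis
    using assms(1) group_one_generated by (simp add: has_prime_exponent_def)
qed

text \<open>Multiplying \<open>(0, 1)\<close> on the right twice by \<open>(w, 0)\<close> gives the second coordinate
  \<open>(1 + w)\<^sup>2\<close>, whereas multiplying once by \<open>(w, 0) (w, 0) = (2 w, 0)\<close> gives \<open>1 + 2 w\<close>.\<close>

lemma not_associative_WU:
  assumes "w \<in> W" "w \<noteq> 0" shows "\<not> associative_loop WU"
proof
  assume *: "associative_loop WU"
  have "((0, 1) \<otimes>\<^bsub>WU\<^esub> (w, 0)) \<otimes>\<^bsub>WU\<^esub> (w, 0) = (0, 1) \<otimes>\<^bsub>WU\<^esub> ((w, 0) \<otimes>\<^bsub>WU\<^esub> (w, 0))"
    using * assms unfolding associative_loop_def by (auto simp: WU_closed)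
  then show False using assms(2) by (simp add: mult_Q algebra_simps)
qed

end

section \<open>Generation\<close>

text \<open>For a subloop \<open>H\<close> the elements over 0 form an additive group, and this is its ring of
  multipliers. It turns the closure of \<open>H\<close> under the loop operations into ring membership.\<close>

definition multipliers :: "('k::field \<times> 'k) set \<Rightarrow> 'k set" where
  "multipliers H = {r. \<forall>v. (0, v) \<in> H \<longrightarrow> (0, r * v) \<in> H}"

context Q_subloop
begin

context
  fixes H w p
  assumes H: "subloop H (Q_loop W)" and w: "(w, 0) \<in> H" and W_cyclic: "W = range (\<lambda>n. of_int n * w)"
    and odd: "odd p" and char: "of_nat p = (0 :: 'k)"
begin

lemma H_closed:
  "x \<in> H \<Longrightarrow> y \<in> H \<Longrightarrow> x \<otimes>\<^bsub>Q_loop W\<^esub> y \<in> H"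
  "x \<in> H \<Longrightarrow> y \<in> H \<Longrightarrow> left_div (Q_loop W) x y \<in> H"
  "x \<in> H \<Longrightarrow> y \<in> H \<Longrightarrow> right_div (Q_loop W) y x \<in> H"
  using H by (auto simp: subloop_def)

lemma H_zero: "(0, 0) \<in> H"
  using Q.subloop_one[OF H] by (simp add: one_Q)

lemma H_diff: "(0, u) \<in> H \<Longrightarrow> (0, v) \<in> H \<Longrightarrow> (0, u - v) \<in> H"
  using H_closed(2)[of "(0, v)" "(0, u)"] by (simp add: left_div_Q W_zero)

lemma H_add: "(0, u) \<in> H \<Longrightarrow> (0, v) \<in> H \<Longrightarrow> (0, u + v) \<in> H"
  using H_closed(1)[of "(0, u)" "(0, v)"] by (simp add: mult_Q)

lemma H_W: "a \<in> W \<Longrightarrow> (a, 0) \<in> H"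
proof -
  have w': "w \<in> W" using w H by (auto simp: subloop_def carrier_Q)
  have "(of_int n * w, 0) \<in> H" for n
  proof (induction n rule: int_induct[of _ 0])
    case (step1 i)
    then show ?case using H_closed(1)[OF step1(2) w] by (simp add: mult_Q distrib_right)
  next
    case (step2 i)
    then show ?case
      using H_closed(3)[OF w step2(2)] w' by (simp add: right_div_Q W_of_int left_diff_distrib)
  qed (use H_zero in simp)
  then show "a \<in> W \<Longrightarrow> (a, 0) \<in> H" using W_cyclic by auto
qed

lemma multipliers_ring:
  "1 \<in> multipliers H"
  "r \<in> multipliers H \<Longrightarrow> s \<in> multipliers H \<Longrightarrow> r + s \<in> multipliers H"
  "r \<in> multipliers H \<Longrightarrow> s \<in> multipliers H \<Longrightarrow> r - s \<in> multipliers H"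
  "r \<in> multipliers H \<Longrightarrow> s \<in> multipliers H \<Longrightarrow> r * s \<in> multipliers H"
  using H_add H_diff by (auto simp: multipliers_def distrib_right left_diff_distrib mult.assoc)

lemma multipliers_of_int: "of_int n \<in> multipliers H"
proof (induction n rule: int_induct[of _ 0])
  case base
  show ?case using multipliers_ring(3)[OF multipliers_ring(1) multipliers_ring(1)] by simp
qed (auto intro: multipliers_ring)

text \<open>\<open>(a, 0) (0, v) = (a, v (1 - a)) = (0, v (1 - a) / (1 + a)) (a, 0)\<close>, so right division
  shows that \<open>(1 - a) / (1 + a)\<close> is a multiplier. Adding 1 gives \<open>2 / (1 + a)\<close>.\<close>

lemma multipliers_inverse:
  assumes a: "a \<in> W" shows "inverse (1 + a) \<in> multipliers H"
proof -
  have "(0, (1 - a) / (1 + a) * v) \<in> H" if v: "(0, v) \<in> H" for v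
  proof -
    have "(a, v * (1 - a)) \<in> H"
      using H_closed(1)[OF H_W[OF a] v] by (simp add: mult_Q)
    from H_closed(3)[OF H_W[OF a] this] show ?thesis
      by (simp add: right_div_Q a mult.commute)
  qed
  then have *: "(1 - a) / (1 + a) \<in> multipliers H" by (simp add: multipliers_def)
  \<comment> \<open>In the field \<open>2 h = p + 1 = 1\<close>, so \<open>h\<close> is the integer to multiply \<open>2 / (1 + a)\<close> with.\<close>
  obtain h where h: "p + 1 = 2 * h" using odd by (metis even_plus_one_iff evenE)
  have "(2 :: 'k) * of_nat h = of_nat (p + 1)" by (simp only: h of_nat_mult of_nat_numeral)
  also have "\<dots> = 1" using char by simp
  finally have "of_nat h * (1 + (1 - a) / (1 + a)) = inverse (1 + a)"
    using unit[OF a] by (simp add: field_simps)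
  then show ?thesis
    using multipliers_ring(4)[OF multipliers_of_int[of "int h"] multipliers_ring(2)[OF multipliers_ring(1) *]]
    by (metis of_int_of_nat_eq)
qed

text \<open>\<open>((0, v) (a, 0)) (- a, 0) = (a, v (1 + a)) (- a, 0) = (0, v (1 + a) (1 - a))\<close>.\<close>

lemma multipliers_square:
  assumes a: "a \<in> W" shows "a\<^sup>2 \<in> multipliers H"
proof -
  have "(0, (1 - a\<^sup>2) * v) \<in> H" if v: "(0, v) \<in> H" for v
  proof -
    have "(a, v * (1 + a)) \<in> H"
      using H_closed(1)[OF v H_W[OF a]] by (simp add: mult_Q)
    from H_closed(1)[OF this H_W[OF W_uminus[OF a]]] show ?thesis
      by (simp add: mult_Q power2_eq_square algebra_simps)
  qed
  then have "1 - a\<^sup>2 \<in> multipliers H" by (simp add: multipliers_def)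
  from multipliers_ring(3)[OF multipliers_ring(1) this] show ?thesis by simp
qed

text \<open>Multiplying the identity below by \<open>1 + a\<close> turns it into \<open>a + a\<^sup>2 = a\<^sup>2 + (1 + a) - 1\<close>.\<close>

lemma multipliers_W:
  assumes a: "a \<in> W" shows "a \<in> multipliers H"
proof -
  have "(1 + a) * a = (1 + a) * (a\<^sup>2 * inverse (1 + a) + 1 - inverse (1 + a))"
    using unit[OF a] by (simp add: distrib_left right_diff_distrib mult.left_commute[of "1 + a"])
      (simp add: power2_eq_square algebra_simps)
  then have "a = a\<^sup>2 * inverse (1 + a) + 1 - inverse (1 + a)"
    using unit[OF a] by (metis mult_left_cancel)
  then show ?thesis
    using multipliers_ring multipliers_square[OF a] multipliers_inverse[OF a] by metis
qed

text \<open>\<open>(a, u) = (a, 0) (0, u / (1 - a))\<close>, and \<open>1 - a\<close> is a unit of \<open>U\<close>.\<close>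

lemma WU_subset:
  assumes "(0, 1) \<in> H" "U \<subseteq> multipliers H"
  shows "W \<times> U \<subseteq> H"
proof clarify
  fix a u assume au: "a \<in> W" "u \<in> U"
  then have "u / (1 - a) \<in> multipliers H" using assms(2) U_divide' by blast
  then have "(0, u / (1 - a)) \<in> H" using assms(1) by (force simp: multipliers_def)
  from H_closed(1)[OF H_W[OF au(1)] this] show "(a, u) \<in> H"
    using unit'[OF au(1)] by (simp add: mult_Q)
qed

end

end

section \<open>Formal Laurent series\<close>

lemma poly_localization_ring:
  "1 \<in> poly_localization W"
  "u \<in> poly_localization W \<Longrightarrow> v \<in> poly_localization W \<Longrightarrow> u - v \<in> poly_localization W"
  "u \<in> poly_localization W \<Longrightarrow> v \<in> poly_localization W \<Longrightarrow> u * v \<in> poly_localization W"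
  "fps_to_fls (fps_of_poly f) \<in> poly_localization W"
  "a \<in> W \<Longrightarrow> inverse (1 + a) \<in> poly_localization W"
proof -
  let ?S = "range (\<lambda>f :: 'a poly. fps_to_fls (fps_of_poly f)) \<union> {inverse (1 + a) |a. a \<in> W}"
  note g = generate_ring.intros[where R = class_ring and H = ?S, simplified class_ring_simps monoid.simps ring.simps]
  show "1 \<in> poly_localization W" unfolding poly_localization_def by (rule g(1))
  show "fps_to_fls (fps_of_poly f) \<in> poly_localization W"
    unfolding poly_localization_def by (rule g(2)) blast
  show "inverse (1 + a) \<in> poly_localization W" if "a \<in> W"
    unfolding poly_localization_def by (rule g(2)) (use that in blast)
  show "u * v \<in> poly_localization W"
    if "u \<in> poly_localization W" "v \<in> poly_localization W"
    using that unfolding poly_localization_def by (rule g(5))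
  show "u - v \<in> poly_localization W"
    if "u \<in> poly_localization W" "v \<in> poly_localization W"
    using g(4)[OF _ g(3), of u v] that unfolding poly_localization_def by simp
qed

lemma poly_localization_least:
  fixes R :: "'a::field fls set"
  assumes one: "1 \<in> R" and diff: "\<And>r s. r \<in> R \<Longrightarrow> s \<in> R \<Longrightarrow> r - s \<in> R"
    and mult: "\<And>r s. r \<in> R \<Longrightarrow> s \<in> R \<Longrightarrow> r * s \<in> R"
    and const: "\<And>c. fls_const c \<in> R" and X: "fls_X \<in> R"
    and inv: "\<And>a. a \<in> W \<Longrightarrow> inverse (1 + a) \<in> R"
  shows "poly_localization W \<subseteq> R"
proof
  have uminus: "- r \<in> R" if "r \<in> R" for r using diff[OF diff[OF one one] that] by simp
  have add: "r + s \<in> R" if "r \<in> R" "s \<in> R" for r s using diff[OF that(1) uminus[OF that(2)]] by simp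
  have poly: "fps_to_fls (fps_of_poly f) \<in> R" for f
  proof (induction f)
    case 0
    then show ?case using diff[OF one one] by simp
  next
    case (pCons c f)
    have "fps_to_fls (fps_of_poly (pCons c f)) = fls_const c + fps_to_fls (fps_of_poly f) * fls_X"
      by (simp add: fps_of_poly_pCons fls_times_fps_to_fls)
    then show ?case using add const mult X pCons by simp
  qed
  fix u assume "u \<in> poly_localization W"
  then show "u \<in> R" unfolding poly_localization_def
  proof (induction rule: generate_ring.induct)
  qed (auto simp: class_ring_simps one poly inv uminus add mult)
qed

text \<open>The powers of the indeterminate are distinct already as polynomials.\<close>

lemma infinite_poly_localization: "infinite (poly_localization W)"
proof -
  have "inj (\<lambda>n. fps_to_fls (fps_of_poly (monom (1::'a) n)))"
    by (auto simp: inj_def fps_of_poly_eq_iff monom_eq_iff')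
  then have "infinite (range (\<lambda>n. fps_to_fls (fps_of_poly (monom (1::'a) n))))"
    using finite_imageD by blast
  moreover have "range (\<lambda>n. fps_to_fls (fps_of_poly (monom (1::'a) n))) \<subseteq> poly_localization W"
    using poly_localization_ring(4) by blast
  ultimately show ?thesis using finite_subset by blast
qed

lemma mod_ring_eq_of_int: "\<exists>n. c = of_int n" for c :: "'p::nontriv mod_ring"
  by (metis of_int_of_int_mod_ring of_int_mod_ring_to_int_mod_ring)

text \<open>Every residue is an integer multiple of 1. With the indeterminate for \<open>x\<close> this makes the
  scalar multiples of the indeterminate a cyclic additive group.\<close>

lemma fls_const_multiples:
  "range (\<lambda>c :: 'p::nontriv mod_ring. fls_const c * x) = range (\<lambda>n. of_int n * x)"
proof safe
  fix c :: "'p mod_ring"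
  show "fls_const c * x \<in> range (\<lambda>n. of_int n * x)"
    using mod_ring_eq_of_int[of c] by (auto simp flip: fls_of_int)
qed (auto simp: fls_of_int)

lemma Q_subloop_poly_localization:
  fixes W :: "'p::prime_card mod_ring fls set"
  defines "W \<equiv> range (\<lambda>c. fls_const c * fls_X)"
  shows "Q_subloop W (poly_localization W)"
proof
  show "0 \<in> W" unfolding W_def by (rule image_eqI[of _ _ 0]) auto
next
  fix a b assume "a \<in> W" "b \<in> W"
  then obtain c d where "a = fls_const c * fls_X" "b = fls_const d * fls_X" by (auto simp: W_def)
  then have "a - b = fls_const (c - d) * fls_X"
    by (simp add: left_diff_distrib flip: fls_minus_const)
  then show "a - b \<in> W" unfolding W_def by blast
next
  fix a assume "a \<in> W"
  then have "fls_nth (1 + a) 0 = 1" by (auto simp: W_def)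
  then show "1 + a \<noteq> 0" by (metis fls_zero_nth zero_neq_one)
next
  have "fls_const c * fls_X \<in> poly_localization W" for c
    using poly_localization_ring(4)[of "[:0, c:]" W]
    by (simp add: fps_of_poly_pCons fls_times_fps_to_fls)
  then show "W \<subseteq> poly_localization W" by (auto simp: W_def)
qed (auto intro: poly_localization_ring)

theorem lemma5p1:
  fixes p :: nat
    and W U :: "'p::prime_card mod_ring fls set"
    and Q L :: "('p mod_ring fls \<times> 'p mod_ring fls) monoid"
  assumes p: "p = CARD('p)" "odd p"
    and W: "W = range (\<lambda>c. fls_const c * fls_X)"
    and Q: "Q = Q_loop W"
    and L: "L = subloop_generated Q {(fls_X, 0), (0, 1)}"
    and U: "U = poly_localization W"
  shows "carrier L = W \<times> U \<and>
    infinite (carrier L) \<and>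
    \<not> associative_loop L \<and>
    two_generated L \<and>
    abelian_by_cyclic L \<and>
    automorphic_loop L \<and>
    has_prime_exponent L p"
proof -
  interpret Q_subloop W U
    unfolding U W by (rule Q_subloop_poly_localization)
  have cyclic: "W = range (\<lambda>n. of_int n * fls_X)"
    unfolding W by (rule fls_const_multiples)
  have char: "of_nat p = (0 :: 'p mod_ring fls)"
    by (simp add: p(1) fls_of_nat)
  have X: "fls_X \<in> W" unfolding cyclic by (rule range_eqI[of _ _ 1]) simp
  let ?S = "{(fls_X, 0), (0, 1 :: 'p mod_ring fls)}"
  have S: "?S \<subseteq> W \<times> U" using X by (auto simp: WU_closed)
  have gen: "loop_generate Q ?S = W \<times> U"
  proof
    show "loop_generate Q ?S \<subseteq> W \<times> U"
      unfolding Q using subloop_WU S by (rule Q.loop_generate_least)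
    define H where "H = loop_generate Q ?S"
    have H: "subloop H (Q_loop W)"
      unfolding H_def Q by (rule Q.subloop_loop_generate) (use X in \<open>auto simp: carrier_Q WU_closed\<close>)
    have SH: "?S \<subseteq> H" unfolding H_def Q by (rule Q.loop_generate_incl)
    then have wH: "(fls_X, 0) \<in> H" "(0, 1) \<in> H" by auto
    note ctx = H wH(1) cyclic p(2) char
    have const: "fls_const c \<in> multipliers H" for c
      using mod_ring_eq_of_int[of c] multipliers_of_int[OF ctx] by (metis fls_of_int)
    have "U \<subseteq> multipliers H"
      unfolding U
      by (rule poly_localization_least)
        (auto intro: multipliers_ring[OF ctx] const multipliers_W[OF ctx] X
          multipliers_inverse[OF ctx])
    then show "W \<times> U \<subseteq> loop_generate Q ?S"
      using WU_subset[OF ctx wH(2)] by (simp add: H_def)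
  qed
  then have LWU: "L = WU" using L Q by simp
  have "infinite U" unfolding U by (rule infinite_poly_localization)
  then have "infinite (W \<times> U)" using X finite_cartesian_productD2 by blast
  moreover have "two_generated L"
    unfolding two_generated_def LWU
  proof (intro bexI)
    show "loop_generate WU ?S = carrier WU"
      using Q.loop_generate_in_subloop[OF subloop_WU S] gen[unfolded Q] by simp
  qed (use S in simp_all)
  moreover have "has_prime_exponent L p"
    unfolding LWU by (rule prime_exponent_WU[OF _ char]) (simp add: p(1) prime_card)
  moreover have "\<not> associative_loop L"
    unfolding LWU by (rule not_associative_WU[OF X]) simp
  moreover have "abelian_by_cyclic L" "automorphic_loop L"
    unfolding LWU using abelian_by_cyclic_WU[OF cyclic] automorphic_WU by auto
  ultimately show ?thesis by (simp add: LWU)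
qed

end
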